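(* Every integer $n\ge1$ can be uniquely written in the form $$n=l_{\alpha_1}*(l_{\alpha_2}*(l_{\alpha_3}*(\cdots*l_{\alpha_k})\cdots)),$$ where $k\ge1$, $l_{\alpha_i}\in\mathbb L$ for all $i<k$, and $l_{\alpha_k}\in A_\infty$.
   Context: Lucky numbers: let $A_0=\mathbb N=\{1,2,3,\dots\}$. Remove every second element of $A_0$ to get $A_1=\{1,3,5,7,\dots\}$. Take the next remaining number, $3$, and remove every third element of $A_1$ (in increasing order) to get $A_2=\{1,3,7,9,13,\dots\}$. Take the next remaining number, $7$, and remove every seventh element of $A_2$ to get $A_3$, and so on. The set of lucky numbers is $A_\infty=\bigcap_i A_i=\{1,3,7,9,13,15,21,25,31,33,\dots\}$. For $n\ge2$, $l_n$ denotes the $n$th lucky number ($l_2=3$, $l_3=7$, $l_4=9,\dots$), and by convention $l_1=2$. Thus $A_i$ is obtained from $A_{i-1}$ by removing every $l_i$-th element, for all $i\ge1$. Let $\mathbb L=(A_\infty\setminus\{1\})\cup\{2\}=\{l_1,l_2,l_3,\dots\}=\{2,3,7,9,13,15,\dots\}$. The operation $*:\mathbb L\times\mathbb N\to\mathbb N$ is defined by letting $l_i*n$ be the $n$th number eliminated by $l_i$ in the sifting process, i.e. $l_i*n$ is the $(l_in)$th element (in increasing order) of $A_{i-1}$. For example $2*3=6$ and $3*1=5$. In the representation in the claim, the last entry, written $l_{\alpha_k}$, may be any element of $A_\infty$, including $1$; for $k=1$ the expression is just $n=l_{\alpha_1}\in A_\infty$. *)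

theory Defs
  imports Main "HOL-Library.Infinite_Set"
begin

definition nth_element :: "nat set \<Rightarrow> nat \<Rightarrow> nat" where
  "nth_element S n = enumerate S (n - 1)"

definition remove_every :: "nat \<Rightarrow> nat set \<Rightarrow> nat set" where
  "remove_every m S = S - {nth_element S (m * k) | k. k \<ge> 1}"

text \<open>
  \<^term>\<open>lucky_sieve i\<close> is $A_i$, and \<^term>\<open>lucky_sifter i\<close> is the number by which
  $A_i$ is sifted, i.e. the one that produces $A_{i+1}$. The first sifter is 2, and each
  later one is the next remaining number after the previous sifter.
\<close>
function lucky_sieve :: "nat \<Rightarrow> nat set" and lucky_sifter :: "nat \<Rightarrow> nat" where
  "lucky_sieve 0 = {1..}"
| "lucky_sieve (Suc i) = remove_every (lucky_sifter i) (lucky_sieve i)"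
| "lucky_sifter 0 = 2"
| "lucky_sifter (Suc i) = (LEAST x. x \<in> lucky_sieve (Suc i) \<and> lucky_sifter i < x)"
  by pat_completeness auto
termination
  by (relation "measure (case_sum (\<lambda>i. 2 * i) (\<lambda>i. 2 * i + 1))") auto

definition lucky_numbers :: "nat set" where
  "lucky_numbers = (\<Inter>i. lucky_sieve i)"

text \<open>The sequence $l_1, l_2, \dots$ is indexed from 1; the value at index 0 is irrelevant.\<close>
definition lucky :: "nat \<Rightarrow> nat" where
  "lucky n = (if n = 1 then 2 else nth_element lucky_numbers n)"

definition lucky_L :: "nat set" where
  "lucky_L = (lucky_numbers - {1}) \<union> {2}"

definition lucky_index :: "nat \<Rightarrow> nat" where
  "lucky_index a = (THE i. i \<ge> 1 \<and> lucky i = a)"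

definition lucky_star :: "nat \<Rightarrow> nat \<Rightarrow> nat"  (infixr \<open>\<star>\<close> 70) where
  "a \<star> n = nth_element (lucky_sieve (lucky_index a - 1)) (a * n)"

end

theory Submission
  imports Defs
begin

text \<open>
  Sifting \<open>A\<^sub>i\<close> leaves its first \<open>i + 1\<close> elements alone, because the sifter exceeds \<open>i + 1\<close>.
  Hence the initial segments stabilise, and the sifters are \<open>l\<^sub>1, l\<^sub>2, \<dots>\<close> in order.
  So every \<open>n \<ge> 1\<close> is either lucky or eliminated at exactly one stage, i.e. equal to
  \<open>a \<star> m\<close> for a unique \<open>a \<in> \<bbbL>\<close> and a unique \<open>m \<ge> 1\<close>, where \<open>m < n\<close>; iterate.
\<close>

section \<open>Enumerations of infinite sets and removal of every \<open>m\<close>-th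
  element\<close>

lemma enumerate_subset_eq:
  fixes S T :: "nat set"
  assumes "infinite T" "T \<subseteq> S" "\<And>i. i \<le> j \<Longrightarrow> enumerate S i \<in> T"
  shows "enumerate T j = enumerate S j"
  using assms(3)
proof (induction j)
  case 0
  then have "enumerate S 0 \<in> T" by simp
  then show ?case
    unfolding enumerate_0 using assms(2) by (intro Least_equality) (auto intro: Least_le)
next
  case (Suc j)
  have "infinite S" using assms(1,2) infinite_super by blast
  have mem: "enumerate S (Suc j) \<in> T" using Suc.prems by blast
  have "enumerate T j = enumerate S j" using Suc by simp
  \<comment> \<open>Both sets now seek their least member above the same number. The candidate from
    \<open>S\<close> lies in \<open>T\<close>, and \<open>T\<close> offers no others.\<close>
  then have "enumerate T (Suc j) = (LEAST s. s \<in> T \<and> enumerate S j < s)"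
    using enumerate_Suc''[OF assms(1)] by simp
  also have "\<dots> = enumerate S (Suc j)"
  proof (rule Least_equality)
    show "enumerate S (Suc j) \<in> T \<and> enumerate S j < enumerate S (Suc j)"
      using mem enumerate_step[OF \<open>infinite S\<close>] by blast
  next
    fix y assume "y \<in> T \<and> enumerate S j < y"
    then show "enumerate S (Suc j) \<le> y"
      unfolding enumerate_Suc''[OF \<open>infinite S\<close>] using assms(2) by (intro Least_le) blast
  qed
  finally show ?case .
qed

lemma enumerate_eq_iff:
  fixes S :: "nat set"
  assumes "infinite S"
  shows "enumerate S i = enumerate S j \<longleftrightarrow> i = j"
  using strict_mono_enumerate[OF assms] strict_mono_eq by blast

text \<open>\<open>enumerate\<close> counts from 0 and \<open>nth_element\<close> from 1, so
  position \<open>j\<close> holds element number \<open>Suc j\<close>.\<close>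

lemma enumerate_mem_remove_every_iff:
  assumes "infinite S" "m \<ge> 1"
  shows "enumerate S j \<in> remove_every m S \<longleftrightarrow> \<not> m dvd Suc j"
proof -
  have "(\<exists>k\<ge>1. enumerate S j = nth_element S (m * k)) \<longleftrightarrow> (\<exists>k\<ge>1. Suc j = m * k)"
  proof -
    have "enumerate S j = nth_element S (m * k) \<longleftrightarrow> Suc j = m * k" if "k \<ge> 1" for k
    proof -
      \<comment> \<open>Otherwise the truncated \<open>m * k - 1\<close> would confuse element
        numbers 0 and 1.\<close>
      have "m * k \<ge> 1" using that assms(2) by simp
      then show ?thesis
        unfolding nth_element_def enumerate_eq_iff[OF assms(1)] by linarith
    qed
    then show ?thesis by blast
  qed
  also have "\<dots> \<longleftrightarrow> m dvd Suc j"
    by (metis dvd_def less_one linorder_not_less mult_0_right nat.distinct(1))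
  finally show ?thesis
    using enumerate_in_set[OF assms(1)] unfolding remove_every_def by blast
qed

lemma remove_every_subset: "remove_every m S \<subseteq> S"
  by (auto simp: remove_every_def)

lemma infinite_remove_every:
  assumes "infinite S" "m \<ge> 2"
  shows "infinite (remove_every m S)"
proof -
  \<comment> \<open>The element right after each removed one survives, as does the first; these
    alone are infinitely many.\<close>
  have "\<not> m dvd Suc (m * k)" for k
    using assms(2) dvd_add_right_iff[of m "m * k" 1] by auto
  then have "range (\<lambda>k. enumerate S (m * k)) \<subseteq> remove_every m S"
    using enumerate_mem_remove_every_iff[OF assms(1)] assms(2) by auto
  moreover have "inj (\<lambda>k. enumerate S (m * k))"
    using assms(2) by (intro injI) (simp add: enumerate_eq_iff[OF assms(1)])
  ultimately show ?thesis
    using range_inj_infinite infinite_super by blast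
qed

lemma enumerate_remove_every:
  assumes "infinite S" "Suc j < m"
  shows "enumerate (remove_every m S) j = enumerate S j"
proof (rule enumerate_subset_eq)
  show "infinite (remove_every m S)" using assms by (intro infinite_remove_every) auto
  show "enumerate S i \<in> remove_every m S" if "i \<le> j" for i
    using that assms by (subst enumerate_mem_remove_every_iff) (auto dest: dvd_imp_le)
qed (rule remove_every_subset)

lemma nth_element_ge:
  assumes "infinite S" "0 \<notin> S" "k \<ge> 1"
  shows "nth_element S k \<ge> k"
proof -
  have "Suc j \<le> enumerate S j" for j
  proof (induction j)
    case 0
    then show ?case using enumerate_in_set[OF assms(1), of 0] assms(2) by (cases "enumerate S 0") auto
  next
    case (Suc j)
    then show ?case using enumerate_step[OF assms(1), of j] by linarith
  qed
  from this[of "k - 1"] show ?thesis using assms(3) by (simp add: nth_element_def)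
qed

section \<open>The sieve sets and their sifters\<close>

lemma lucky_sieve_sifter_aux: "infinite (lucky_sieve i) \<and> i + 2 \<le> lucky_sifter i"
\<comment> \<open>The two claims need each other: a sifter of at least 2 keeps the set infinite, and
  an infinite set has a member above the old sifter, so the \<open>LEAST\<close> defining the next
  one is attained.\<close>
proof (induction i)
  case 0
  then show ?case by (simp add: infinite_Ici)
next
  case (Suc i)
  have inf: "infinite (lucky_sieve (Suc i))"
    using Suc infinite_remove_every by simp
  then obtain x where "x \<in> lucky_sieve (Suc i) \<and> lucky_sifter i < x"
    using infinite_nat_iff_unbounded by blast
  then have "lucky_sifter i < lucky_sifter (Suc i)"
    unfolding lucky_sifter.simps by (rule LeastI2) blast
  then show ?case using inf Suc by linarith
qed

lemma infinite_lucky_sieve: "infinite (lucky_sieve i)"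
  and lucky_sifter_ge: "i + 2 \<le> lucky_sifter i"
  using lucky_sieve_sifter_aux by blast+

lemma lucky_sifter_Suc:
  "lucky_sifter (Suc i) \<in> lucky_sieve (Suc i) \<and> lucky_sifter i < lucky_sifter (Suc i)"
proof -
  obtain x where "x \<in> lucky_sieve (Suc i) \<and> lucky_sifter i < x"
    using infinite_lucky_sieve[of "Suc i"] infinite_nat_iff_unbounded by blast
  then show ?thesis unfolding lucky_sifter.simps by (rule LeastI)
qed

lemma strict_mono_lucky_sifter: "strict_mono lucky_sifter"
  using lucky_sifter_Suc by (simp add: strict_mono_Suc_iff)

lemma antimono_lucky_sieve: "i \<le> j \<Longrightarrow> lucky_sieve j \<subseteq> lucky_sieve i"
proof (rule lift_Suc_antimono_le)
  show "lucky_sieve (Suc n) \<subseteq> lucky_sieve n" for n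
    using remove_every_subset by simp
qed

lemma lucky_sieve_pos: "0 \<notin> lucky_sieve i"
  using antimono_lucky_sieve[of 0 i] by auto

section \<open>Stable initial segments and the diagonal\<close>

lemma enumerate_lucky_sieve_Suc:
  assumes "i \<le> j"
  shows "enumerate (lucky_sieve (Suc j)) i = enumerate (lucky_sieve j) i"
proof -
  have "Suc i < lucky_sifter j" using assms lucky_sifter_ge[of j] by linarith
  then show ?thesis using enumerate_remove_every infinite_lucky_sieve by simp
qed

lemma enumerate_lucky_sieve_stable:
  assumes "i \<le> j" "j \<le> k"
  shows "enumerate (lucky_sieve k) i = enumerate (lucky_sieve j) i"
  using assms(2)
proof (induction rule: dec_induct)
  case (step k)
  then show ?case using enumerate_lucky_sieve_Suc[of i k] assms(1) by (simp del: lucky_sieve.simps)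
qed simp

lemma enumerate_lucky_sieve_0_0: "enumerate (lucky_sieve 0) 0 = 1"
  unfolding enumerate_0 by (rule Least_equality) auto

text \<open>The sifter 2 eliminates itself, which is why the diagonal identity below starts at index
  1.\<close>

lemma two_notin_lucky_sieve_1: "2 \<notin> lucky_sieve (Suc 0)"
proof -
  have "enumerate (lucky_sieve 0) (Suc 0) = 2"
    unfolding enumerate_Suc''[OF infinite_lucky_sieve] enumerate_lucky_sieve_0_0
    by (rule Least_equality) auto
  then show ?thesis
    using enumerate_mem_remove_every_iff[OF infinite_lucky_sieve, of 2 0 "Suc 0"] by simp
qed

text \<open>Sifter and diagonal element are each the least member of the same set above their
  predecessor, so it suffices to compare predecessors.\<close>

lemma enumerate_lucky_sieve_diag: "enumerate (lucky_sieve (Suc i)) (Suc i) = lucky_sifter (Suc i)"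
proof (induction i)
  case 0
  \<comment> \<open>Here the predecessors are 1 and 2, but both bounds select the same members, as 2
    is gone.\<close>
  have "1 < x \<longleftrightarrow> lucky_sifter 0 < x" if "x \<in> lucky_sieve (Suc 0)" for x
    using that two_notin_lucky_sieve_1 by (cases "x = 2") (auto simp del: lucky_sieve.simps)
  moreover have "enumerate (lucky_sieve (Suc 0)) 0 = 1"
    using enumerate_lucky_sieve_Suc[of 0 0] enumerate_lucky_sieve_0_0 by simp
  ultimately show ?case
    unfolding enumerate_Suc''[OF infinite_lucky_sieve] lucky_sifter.simps(2)
    by (metis (no_types, lifting))
next
  case (Suc i)
  \<comment> \<open>The next sifting spares position \<open>Suc i\<close>, so the predecessors
    coincide.\<close>
  have "enumerate (lucky_sieve (Suc (Suc i))) (Suc i) = lucky_sifter (Suc i)"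
    using enumerate_lucky_sieve_Suc[of "Suc i" "Suc i"] Suc by simp
  then show ?case
    unfolding enumerate_Suc''[OF infinite_lucky_sieve, of _ "Suc i"] lucky_sifter.simps(2)[of "Suc i"]
    by simp
qed

text \<open>The element keeps its position in all later sets, and it lies in all earlier ones by
  nesting.\<close>

lemma enumerate_lucky_sieve_mem_lucky:
  assumes "i \<le> j"
  shows "enumerate (lucky_sieve j) i \<in> lucky_numbers"
proof -
  have "enumerate (lucky_sieve j) i \<in> lucky_sieve k" for k
  proof (cases "j \<le> k")
    case True
    then show ?thesis
      using enumerate_in_set[OF infinite_lucky_sieve, of k i] enumerate_lucky_sieve_stable[OF assms True]
      by simp
  next
    case False
    then show ?thesis
      using enumerate_in_set[OF infinite_lucky_sieve, of j i] antimono_lucky_sieve[of k j] by auto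
  qed
  then show ?thesis by (simp add: lucky_numbers_def)
qed

section \<open>Lucky numbers and their indices\<close>

lemma infinite_lucky_numbers: "infinite lucky_numbers"
  unfolding infinite_nat_iff_unbounded
proof
  fix m
  \<comment> \<open>The sifters after the first are themselves lucky, and they are
    unbounded.\<close>
  have "lucky_sifter (Suc m) \<in> lucky_numbers"
    using enumerate_lucky_sieve_mem_lucky[of "Suc m" "Suc m"] enumerate_lucky_sieve_diag by simp
  moreover have "m < lucky_sifter (Suc m)" using lucky_sifter_ge[of "Suc m"] by simp
  ultimately show "\<exists>n>m. n \<in> lucky_numbers" by blast
qed

lemma enumerate_lucky_numbers: "enumerate lucky_numbers i = enumerate (lucky_sieve i) i"
proof (rule enumerate_subset_eq[OF infinite_lucky_numbers])
  show "lucky_numbers \<subseteq> lucky_sieve i" by (auto simp: lucky_numbers_def)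
qed (rule enumerate_lucky_sieve_mem_lucky)

lemma enumerate_lucky_numbers_0: "enumerate lucky_numbers 0 = 1"
  using enumerate_lucky_numbers enumerate_lucky_sieve_0_0 by simp

lemma enumerate_lucky_numbers_Suc: "enumerate lucky_numbers (Suc i) = lucky_sifter (Suc i)"
  using enumerate_lucky_numbers enumerate_lucky_sieve_diag by simp

lemma lucky_Suc: "lucky (Suc i) = lucky_sifter i"
  by (cases i) (simp_all add: lucky_def nth_element_def enumerate_lucky_numbers_Suc del: lucky_sifter.simps(2))

text \<open>Strict growth of the sifters makes the index unique, so the \<open>THE\<close> is well
  defined.\<close>

lemma lucky_index_lucky_sifter: "lucky_index (lucky_sifter i) = Suc i"
  unfolding lucky_index_def
proof (rule the_equality)
  fix j assume "j \<ge> 1 \<and> lucky j = lucky_sifter i"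
  then show "j = Suc i"
    using lucky_Suc strict_mono_eq[OF strict_mono_lucky_sifter] by (cases j) auto
qed (simp add: lucky_Suc)

lemma range_nat_eq_insert: "range f = insert (f (0::nat)) (range (\<lambda>i. f (Suc i)))"
proof -
  have "f j \<in> insert (f 0) (range (\<lambda>i. f (Suc i)))" for j
    by (cases j) auto
  then show ?thesis by blast
qed

text \<open>Exchanging 1 for 2 replaces the head of the enumeration of the lucky numbers by the
  first sifter; the tails agree.\<close>

lemma lucky_L_eq_range: "lucky_L = range lucky_sifter"
proof -
  have "lucky_numbers = range (enumerate lucky_numbers)"
    using range_enumerate[OF infinite_lucky_numbers] by simp
  also have "\<dots> = insert 1 (range (\<lambda>i. lucky_sifter (Suc i)))"
    unfolding range_nat_eq_insert[of "enumerate lucky_numbers"]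
    by (simp only: enumerate_lucky_numbers_0 enumerate_lucky_numbers_Suc)
  finally have "lucky_numbers = insert 1 (range (\<lambda>i. lucky_sifter (Suc i)))" .
  moreover have "1 \<noteq> lucky_sifter i" for i using lucky_sifter_ge[of i] by linarith
  then have "1 \<notin> range (\<lambda>i. lucky_sifter (Suc i))" by blast
  moreover have "range lucky_sifter = insert 2 (range (\<lambda>i. lucky_sifter (Suc i)))"
    using range_nat_eq_insert[of lucky_sifter] by (simp only: lucky_sifter.simps(1))
  ultimately show ?thesis unfolding lucky_L_def by blast
qed

section \<open>A single application of the star operation\<close>

lemma lucky_sifter_star: "lucky_sifter i \<star> n = nth_element (lucky_sieve i) (lucky_sifter i * n)"
  by (simp add: lucky_star_def lucky_index_lucky_sifter)

text \<open>By nesting, these differences are disjoint for distinct \<open>i\<close>, so a value of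
  the operation reveals its stage.\<close>

lemma lucky_sifter_star_mem:
  assumes "n \<ge> 1"
  shows "lucky_sifter i \<star> n \<in> lucky_sieve i - lucky_sieve (Suc i)"
  using assms enumerate_in_set[OF infinite_lucky_sieve]
  by (auto simp: lucky_sifter_star remove_every_def nth_element_def)

text \<open>This strict growth makes the descent in the existence proof terminate.\<close>

lemma less_lucky_star:
  assumes "a \<in> lucky_L" "n \<ge> 1"
  shows "n < a \<star> n"
proof -
  obtain i where a: "a = lucky_sifter i" using assms(1) lucky_L_eq_range by blast
  have "n < 2 * n" using assms(2) by simp
  also have "\<dots> \<le> a * n" using lucky_sifter_ge[of i] a by (intro mult_right_mono) auto
  also have "\<dots> \<le> a \<star> n"
    unfolding a lucky_sifter_star using assms(2) lucky_sifter_ge[of i]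
    by (intro nth_element_ge infinite_lucky_sieve lucky_sieve_pos) simp
  finally show ?thesis .
qed

lemma lucky_star_notin_lucky_numbers:
  assumes "a \<in> lucky_L" "n \<ge> 1"
  shows "a \<star> n \<notin> lucky_numbers"
proof -
  obtain i where "a = lucky_sifter i" using assms(1) lucky_L_eq_range by blast
  then have "a \<star> n \<notin> lucky_sieve (Suc i)" using lucky_sifter_star_mem[OF assms(2)] by blast
  then show ?thesis unfolding lucky_numbers_def by blast
qed

lemma lucky_star_inject:
  assumes "a \<in> lucky_L" "b \<in> lucky_L" "m \<ge> 1" "n \<ge> 1" "a \<star> m = b \<star> n"
  shows "a = b \<and> m = n"
proof -
  obtain i j where ij: "a = lucky_sifter i" "b = lucky_sifter j"
    using assms(1,2) lucky_L_eq_range by blast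
  have x: "a \<star> m \<in> lucky_sieve i - lucky_sieve (Suc i)" "a \<star> m \<in> lucky_sieve j - lucky_sieve (Suc j)"
    using lucky_sifter_star_mem assms ij by metis+
  have "i = j"
  proof (rule ccontr)
    assume "i \<noteq> j"
    then have "Suc i \<le> j \<or> Suc j \<le> i" by linarith
    then show False using x antimono_lucky_sieve[of "Suc i" j] antimono_lucky_sieve[of "Suc j" i] by blast
  qed
  \<comment> \<open>Within one stage, equal elements have equal positions; positivity of both
    products then undoes the truncated subtraction.\<close>
  then have "lucky_sifter i * m - 1 = lucky_sifter i * n - 1"
    using assms(5) unfolding ij lucky_sifter_star nth_element_def
    by (simp add: enumerate_eq_iff[OF infinite_lucky_sieve])
  moreover have pos: "lucky_sifter i > 0" using lucky_sifter_ge[of i] by linarith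
  then have "lucky_sifter i * m \<ge> 1" "lucky_sifter i * n \<ge> 1" using assms(3,4) by simp_all
  ultimately have "lucky_sifter i * m = lucky_sifter i * n" by linarith
  then show ?thesis using pos ij \<open>i = j\<close> by simp
qed

lemma lucky_star_exists:
  assumes "n \<ge> 1" "n \<notin> lucky_numbers"
  shows "\<exists>a\<in>lucky_L. \<exists>m\<ge>1. n = a \<star> m"
proof -
  obtain j where "n \<notin> lucky_sieve j" using assms(2) lucky_numbers_def by auto
  moreover have "n \<in> lucky_sieve 0" using assms(1) by simp
  \<comment> \<open>Some step from membership at 0 to non-membership at \<open>j\<close> must lose
    \<open>n\<close>.\<close>
  ultimately obtain i where "n \<in> lucky_sieve i" "n \<notin> lucky_sieve (Suc i)"
    by (induction j) blast+
  then obtain m where "m \<ge> 1" "n = lucky_sifter i \<star> m"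
    unfolding lucky_sifter_star by (auto simp: remove_every_def)
  then show ?thesis unfolding lucky_L_eq_range by blast
qed

lemma lucky_numbers_pos: "n \<in> lucky_numbers \<Longrightarrow> n \<ge> 1"
  using lucky_sieve_pos[of 0] unfolding lucky_numbers_def by (metis INT_D UNIV_I less_one not_le)

section \<open>Iterated star and the unique representation\<close>

lemma foldr_lucky_star_pos:
  assumes "set xs \<subseteq> lucky_L" "x \<in> lucky_numbers"
  shows "foldr (\<star>) xs x \<ge> 1"
  using assms(1)
proof (induction xs)
  case Nil
  then show ?case using lucky_numbers_pos assms(2) by simp
next
  case (Cons a xs)
  then show ?case using less_lucky_star[of a "foldr (\<star>) xs x"] by simp
qed

text \<open>Heads are peeled off by \<open>lucky_star_inject\<close>. The lists cannot run out at
  different times, since one value would then be lucky and the other eliminated.\<close>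

lemma foldr_lucky_star_inject:
  assumes "set xs \<subseteq> lucky_L" "set ys \<subseteq> lucky_L" "x \<in> lucky_numbers" "y \<in> lucky_numbers"
    and "foldr (\<star>) xs x = foldr (\<star>) ys y"
  shows "xs = ys \<and> x = y"
  using assms
proof (induction xs arbitrary: ys)
  case Nil
  show ?case
  proof (cases ys)
    case (Cons b bs)
    then have "foldr (\<star>) ys y \<notin> lucky_numbers"
      using Nil.prems foldr_lucky_star_pos[of bs y]
        lucky_star_notin_lucky_numbers[of b "foldr (\<star>) bs y"] by simp
    then show ?thesis using Nil.prems by simp
  qed (use Nil.prems in simp)
next
  case (Cons a as)
  have pos: "foldr (\<star>) as x \<ge> 1" using Cons.prems by (intro foldr_lucky_star_pos) auto
  show ?case
  proof (cases ys)
    case Nil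
    then show ?thesis
      using Cons.prems pos lucky_star_notin_lucky_numbers[of a "foldr (\<star>) as x"] by simp
  next
    case (Cons b bs)
    have "foldr (\<star>) bs y \<ge> 1" using Cons.prems Cons by (intro foldr_lucky_star_pos) auto
    then have "a = b \<and> foldr (\<star>) as x = foldr (\<star>) bs y"
      using Cons.prems Cons pos by (intro lucky_star_inject) auto
    then show ?thesis using Cons.IH[of bs] Cons.prems Cons by simp
  qed
qed

lemma foldr_lucky_star_exists:
  assumes "n \<ge> 1"
  shows "\<exists>xs x. set xs \<subseteq> lucky_L \<and> x \<in> lucky_numbers \<and> n = foldr (\<star>) xs x"
  using assms
proof (induction n rule: less_induct)
  case (less n)
  show ?case
  proof (cases "n \<in> lucky_numbers")
    case True
    then have "set [] \<subseteq> lucky_L \<and> n \<in> lucky_numbers \<and> n = foldr (\<star>) [] n" by simp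
    then show ?thesis by blast
  next
    case False
    then obtain a m where am: "a \<in> lucky_L" "m \<ge> 1" "n = a \<star> m"
      using lucky_star_exists less.prems by blast
    \<comment> \<open>The induction hypothesis applies because \<open>less_lucky_star\<close> gives
      \<open>m < n\<close>.\<close>
    then obtain xs x where "set xs \<subseteq> lucky_L" "x \<in> lucky_numbers" "m = foldr (\<star>) xs x"
      using less.IH[of m] less_lucky_star by blast
    then have "set (a # xs) \<subseteq> lucky_L \<and> x \<in> lucky_numbers \<and> n = foldr (\<star>) (a # xs) x"
      using am by simp
    then show ?thesis by blast
  qed
qed

theorem theorem3p3:
  fixes n :: nat
  assumes "n \<ge> 1"
  shows "\<exists>!as. as \<noteq> [] \<and> set (butlast as) \<subseteq> lucky_L \<and> last as \<in> lucky_numbers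
           \<and> n = foldr (\<star>) (butlast as) (last as)"
proof -
  obtain xs x where "set xs \<subseteq> lucky_L" "x \<in> lucky_numbers" "n = foldr (\<star>) xs x"
    using foldr_lucky_star_exists[OF assms] by blast
  \<comment> \<open>A nonempty list corresponds to the pair of its \<open>butlast\<close> and its
    \<open>last\<close>, so uniqueness transfers from such pairs.\<close>
  then show ?thesis
  proof (intro ex1I[of _ "xs @ [x]"])
    fix as
    assume "as \<noteq> [] \<and> set (butlast as) \<subseteq> lucky_L \<and> last as \<in> lucky_numbers
      \<and> n = foldr (\<star>) (butlast as) (last as)"
    with \<open>set xs \<subseteq> lucky_L\<close> \<open>x \<in> lucky_numbers\<close> \<open>n = foldr (\<star>) xs x\<close>
    have "as \<noteq> []" "butlast as = xs \<and> last as = x"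
      using foldr_lucky_star_inject[of "butlast as" xs "last as" x] by auto
    then show "as = xs @ [x]" using append_butlast_last_id by metis
  qed simp
qed

end
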